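(* There exists some $\beta_0>0$ such that if $\lambda>0$ and $0<|\beta|<\beta_0$, then the system $$\mathcal L\Big(u-\lambda\big(1+\tfrac1{3\beta^2}\big)\eta\Big)+\Big(\tfrac{\lambda}{3\beta^2}+u\Big)\eta=0,\qquad \mathcal L(\eta-\lambda u)+\tfrac12u^2=0\qquad\text{on }\mathbb R$$ does not admit any monotone front solution.
   Context: Here $\beta\in\mathbb R\setminus\{0\}$ and $\mathcal L=1-\beta^2\partial_x^2$. For $\lambda>0$ with $\lambda^2\big(1+\frac1{3\beta^2}\big)<1$, a triple $(u,\eta,\lambda)$ is called a monotone front solution of the system if $u,\eta\in C^2(\mathbb R)$ have bounded $C^2(\mathbb R)$ norms, $(u,\eta)$ solves the system on $\mathbb R$, and $$\lim_{x\to+\infty}(u(x),\eta(x))=(0,0),\qquad u>0,\quad \eta<0,\quad u'\le0,\quad\eta'\ge0\quad\text{in }\mathbb R.$$ (Monotone fronts are by definition only considered for $\lambda>0$ with $\lambda^2(1+\frac1{3\beta^2})<1$.) *)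

theory Defs
  imports "HOL-Analysis.Analysis"
begin

definition C2 :: "(real \<Rightarrow> real) \<Rightarrow> bool" where
  "C2 f \<longleftrightarrow> f differentiable_on UNIV \<and> deriv f differentiable_on UNIV \<and>
     continuous_on UNIV (deriv (deriv f))"

(* Finiteness of the C^2 norm sup |f| + sup |f'| + sup |f''|. *)
definition bounded_C2_norm :: "(real \<Rightarrow> real) \<Rightarrow> bool" where
  "bounded_C2_norm f \<longleftrightarrow>
     bounded (range f) \<and> bounded (range (deriv f)) \<and> bounded (range (deriv (deriv f)))"

definition L_op :: "real \<Rightarrow> (real \<Rightarrow> real) \<Rightarrow> real \<Rightarrow> real" where
  "L_op \<beta> f x = f x - \<beta>\<^sup>2 * deriv (deriv f) x"

(* lam stands for the parameter lambda of the system (a reserved symbol in Isabelle). *)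
definition solves_system ::
    "real \<Rightarrow> real \<Rightarrow> (real \<Rightarrow> real) \<Rightarrow> (real \<Rightarrow> real) \<Rightarrow> bool" where
  "solves_system \<beta> lam u \<eta> \<longleftrightarrow>
     (\<forall>x. L_op \<beta> (\<lambda>y. u y - lam * (1 + 1 / (3 * \<beta>\<^sup>2)) * \<eta> y) x
            + (lam / (3 * \<beta>\<^sup>2) + u x) * \<eta> x = 0 \<and>
          L_op \<beta> (\<lambda>y. \<eta> y - lam * u y) x + 1 / 2 * (u x)\<^sup>2 = 0)"

(* Only x --> +infinity carries a limit condition; the behaviour at -infinity is
   constrained by boundedness and monotonicity alone. *)
definition monotone_front ::
    "real \<Rightarrow> (real \<Rightarrow> real) \<Rightarrow> (real \<Rightarrow> real) \<Rightarrow> real \<Rightarrow> bool" where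
  "monotone_front \<beta> u \<eta> lam \<longleftrightarrow>
     lam > 0 \<and> lam\<^sup>2 * (1 + 1 / (3 * \<beta>\<^sup>2)) < 1 \<and>
     C2 u \<and> C2 \<eta> \<and> bounded_C2_norm u \<and> bounded_C2_norm \<eta> \<and>
     solves_system \<beta> lam u \<eta> \<and>
     ((\<lambda>x. (u x, \<eta> x)) \<longlongrightarrow> (0, 0)) at_top \<and>
     (\<forall>x. u x > 0 \<and> \<eta> x < 0 \<and> deriv u x \<le> 0 \<and> deriv \<eta> x \<ge> 0)"

end

theory Submission
  imports Defs
begin

text \<open>
  Write \<open>V = u\<^sup>2/2 + u\<^sup>2\<eta>/2 + \<eta>\<^sup>2/2 - \<lambda>u\<eta>\<close>, \<open>p = u - \<mu>\<eta>\<close> with \<open>\<mu> = \<lambda>(1 + 1/(3\<beta>\<^sup>2))\<close>, and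
  \<open>z = \<eta> - \<lambda>u\<close>. The system reads \<open>\<beta>\<^sup>2 p'' = V\<^sub>u\<close>, \<open>\<beta>\<^sup>2 z'' = V\<^sub>\<eta>\<close>, so that
  \<open>(\<beta>\<^sup>2 (p'\<^sup>2 + z'\<^sup>2)/2 - V)' = - \<mu> V\<^sub>u \<eta>' - \<lambda> V\<^sub>\<eta> u'\<close>.
  At \<open>-\<infinity>\<close> a front converges to a nonzero critical point \<open>(U, H)\<close> of \<open>V\<close>, and monotonicity
  forces \<open>V\<^sub>u \<ge> 0\<close> along the front, while \<open>V\<^sub>\<eta> \<le> u\<^sup>2/2\<close> is clear. Hence
  \<open>\<Phi> = \<beta>\<^sup>2 (p'\<^sup>2 + z'\<^sup>2)/2 - V + \<lambda>u\<^sup>3/6\<close> is nonincreasing, and it is nonnegative because its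
  limit at \<open>+\<infinity>\<close> is. As \<open>p'\<close> and \<open>z'\<close> come arbitrarily close to \<open>0\<close> near \<open>-\<infinity>\<close>, this gives
  \<open>V(U, H) \<le> \<lambda>U\<^sup>3/6\<close>, which fails for small \<open>\<lambda>\<close> since \<open>V(U, H)\<close> is about \<open>1/2\<close>;
  and \<open>\<lambda>\<close> is of order \<open>\<beta>\<close> by definition of a front.
\<close>

section \<open>Behaviour of bounded functions at -\<infinity>, and basic calculus\<close>

lemma unbounded_if_deriv_bounded_below_at_bot:
  fixes f f' :: "real \<Rightarrow> real"
  assumes deriv: "\<And>x. (f has_real_derivative f' x) (at x)"
    and "bounded (range f)" "e > 0"
    and ev: "eventually (\<lambda>x. f' x \<ge> e) at_bot"
  shows False
proof -
  from \<open>bounded (range f)\<close> obtain B where B: "\<And>x. \<bar>f x\<bar> \<le> B"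
    by (auto simp: bounded_iff)
  from ev obtain N where N: "\<And>x. x \<le> N \<Longrightarrow> f' x \<ge> e"
    by (auto simp: eventually_at_bot_linorder)
  \<comment> \<open>Over an interval of this length slope \<open>e\<close> forces an increment of
    \<open>2 * B + 1\<close>, more than the oscillation \<open>2 * B\<close> that the bound
    allows.\<close>
  define t where "t = (2 * B + 1) / e"
  have "B \<ge> 0" using B[of 0] by linarith
  then have "t > 0" using \<open>e > 0\<close> by (simp add: t_def)
  then obtain x where x: "N - t < x" "x < N" "f N - f (N - t) = (N - (N - t)) * f' x"
    using MVT2[of "N - t" N f f'] deriv by auto
  have "e * t \<le> t * f' x" using N[of x] x \<open>t > 0\<close> by (simp add: mult.commute)
  moreover have "e * t = 2 * B + 1" using \<open>e > 0\<close> by (simp add: t_def)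
  ultimately show False using x B[of N] B[of "N - t"] by (simp add: abs_le_iff)
qed

text \<open>Applied to the derivatives of \<open>p\<close> and \<open>z\<close>, this makes the
  limit of the front a critical point.\<close>

lemma bounded_deriv_limit_at_bot_zero:
  fixes f f' :: "real \<Rightarrow> real"
  assumes deriv: "\<And>x. (f has_real_derivative f' x) (at x)"
    and bdd: "bounded (range f)"
    and lim: "(f' \<longlongrightarrow> c) at_bot"
  shows "c = 0"
proof (rule ccontr)
  assume "c \<noteq> 0"
  then consider "c > 0" | "c < 0" by linarith
  then show False
  proof cases
    case 1
    then have "eventually (\<lambda>x. f' x > c / 2) at_bot"
      using order_tendstoD(1)[OF lim, of "c / 2"] by simp
    then have "eventually (\<lambda>x. f' x \<ge> c / 2) at_bot"
      by (rule eventually_mono) simp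
    then show False
      using unbounded_if_deriv_bounded_below_at_bot[OF deriv bdd, of "c / 2"] 1 by simp
  next
    case 2
    have deriv': "((\<lambda>x. - f x) has_real_derivative - f' x) (at x)" for x
      using DERIV_minus[OF deriv] .
    have bdd': "bounded (range (\<lambda>x. - f x))"
      using bdd by (simp add: bounded_iff)
    have "eventually (\<lambda>x. f' x < c / 2) at_bot"
      using order_tendstoD(2)[OF lim, of "c / 2"] 2 by simp
    then have "eventually (\<lambda>x. - f' x \<ge> - c / 2) at_bot"
      by (rule eventually_mono) simp
    then show False
      using unbounded_if_deriv_bounded_below_at_bot[OF deriv' bdd', of "- c / 2"] 2 by simp
  qed
qed

lemma antimono_bounded_limit_at_bot:
  fixes f :: "real \<Rightarrow> real"
  assumes anti: "antimono f" and bdd: "bounded (range f)"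
  obtains l where "(f \<longlongrightarrow> l) at_bot" "\<And>x. f x \<le> l"
proof
  have ba: "bdd_above (range f)" using bdd by (rule bounded_imp_bdd_above)
  show le: "f x \<le> Sup (range f)" for x using ba by (simp add: cSup_upper)
  show "(f \<longlongrightarrow> Sup (range f)) at_bot"
  proof (rule order_tendstoI)
    fix a assume "a < Sup (range f)"
    then obtain y where "a < f y" using less_cSup_iff[OF _ ba] by auto
    then have "a < f x" if "x \<le> y" for x
      using antimonoD[OF anti that] by linarith
    then show "eventually (\<lambda>x. a < f x) at_bot"
      by (auto simp: eventually_at_bot_linorder)
  next
    fix a assume "Sup (range f) < a"
    then show "eventually (\<lambda>x. f x < a) at_bot"
      using le by (auto intro!: always_eventually intro: le_less_trans)
  qed
qed

lemma antimonoI_deriv_nonpos: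
  fixes f f' :: "real \<Rightarrow> real"
  assumes "\<And>x. (f has_real_derivative f' x) (at x)" "\<And>x. f' x \<le> 0"
  shows "antimono f"
  using assms by (auto intro!: antimonoI DERIV_nonpos_imp_nonincreasing[of _ _ f])

lemma C2_has_derivatives:
  assumes "C2 f"
  shows "(f has_real_derivative deriv f x) (at x)"
    and "(deriv f has_real_derivative deriv (deriv f) x) (at x)"
  using assms
  by (auto simp: C2_def differentiable_on_def DERIV_deriv_iff_real_differentiable)

lemma DERIV_square:
  fixes f :: "real \<Rightarrow> real"
  assumes "(f has_real_derivative D) (at x)"
  shows "((\<lambda>x. (f x)\<^sup>2) has_real_derivative 2 * f x * D) (at x)"
  using DERIV_power[OF assms, of 2] by (simp add: mult_ac)

lemma L_op_diff_scaled:
  assumes "C2 f" "C2 g"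
  shows "L_op \<beta> (\<lambda>y. f y - c * g y) x =
    f x - c * g x - \<beta>\<^sup>2 * (deriv (deriv f) x - c * deriv (deriv g) x)"
proof -
  have "deriv (\<lambda>y. f y - c * g y) = (\<lambda>y. deriv f y - c * deriv g y)"
    by (rule ext, rule DERIV_imp_deriv)
       (auto intro!: derivative_eq_intros C2_has_derivatives assms)
  moreover have "deriv (\<lambda>y. deriv f y - c * deriv g y) x
      = deriv (deriv f) x - c * deriv (deriv g) x"
    by (rule DERIV_imp_deriv) (auto intro!: derivative_eq_intros C2_has_derivatives assms)
  ultimately show ?thesis by (simp add: L_op_def)
qed

section \<open>The potential and its critical points\<close>

definition potential :: "real \<Rightarrow> real \<Rightarrow> real \<Rightarrow> real" where
  "potential lam u \<eta> = u\<^sup>2 / 2 + u\<^sup>2 * \<eta> / 2 + \<eta>\<^sup>2 / 2 - lam * u * \<eta>"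

text \<open>The expression is affine in each variable and vanishes at \<open>(U, H)\<close>. If
  \<open>1 + \<eta> < 0\<close>, it grows along the path that first raises \<open>H\<close> to
  \<open>\<eta>\<close> (slope \<open>U - lam > 0\<close>) and then lowers \<open>U\<close> to
  \<open>u\<close> (slope \<open>1 + \<eta>\<close>).\<close>

lemma partial_u_potential_nonneg:
  fixes u \<eta> U H lam :: real
  assumes "lam > 0" "0 < u" "u \<le> U" "H \<le> \<eta>" "\<eta> < 0" and crit: "U * (1 + H) = lam * H"
  shows "0 \<le> u * (1 + \<eta>) - lam * \<eta>"
proof (cases "1 + \<eta> \<ge> 0")
  case True
  then have "0 \<le> u * (1 + \<eta>)" "lam * \<eta> < 0"
    using assms by (simp_all add: mult_pos_neg)
  then show ?thesis by linarith
next
  case False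
  have *: "(U - lam) * H = - U" using crit by (simp add: algebra_simps)
  then have "U - lam > 0"
    using assms mult_nonpos_nonpos[of "U - lam" H] by (cases "U - lam > 0") linarith+
  then have "(U - lam) * H \<le> (U - lam) * \<eta>" using assms by simp
  then have "0 \<le> U * (1 + \<eta>) - lam * \<eta>" using * by (simp add: algebra_simps)
  also have "\<dots> \<le> u * (1 + \<eta>) - lam * \<eta>"
    using False \<open>u \<le> U\<close> by (simp add: mult_right_mono_neg)
  finally show ?thesis .
qed

text \<open>Criticality gives \<open>potential lam U H = - H * U\<^sup>2 / 4\<close>. Eliminating
  \<open>H\<close> leaves a quadratic equation for \<open>U\<close>, hence \<open>U < 3\<close>, and
  the claim reduces to \<open>lam * U / 6 < 1 - lam\<^sup>2\<close>.\<close>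

lemma potential_at_critical_point:
  fixes U H lam :: real
  assumes "0 < lam" "lam < 1 / 2" "U > 0"
    and crit1: "U * (1 + H) = lam * H" and crit2: "H - lam * U + U\<^sup>2 / 2 = 0"
  shows "lam * U ^ 3 / 6 < potential lam U H"
proof -
  have H: "H = lam * U - U\<^sup>2 / 2" using crit2 by simp
  have "U * (1 + H - lam * (lam - U / 2)) = 0"
    using crit1 unfolding H by (simp add: algebra_simps power2_eq_square)
  then have "1 + H - lam * (lam - U / 2) = 0" using \<open>U > 0\<close> by simp
  then have H': "H = lam\<^sup>2 - lam * U / 2 - 1"
    by (simp add: algebra_simps power2_eq_square)
  have U2: "U\<^sup>2 = 3 * lam * U + 2 - 2 * lam\<^sup>2" using H H' by simp
  have lamU: "lam * U < U / 2" using assms by simp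
  have "U < 3"
  proof (rule ccontr)
    assume "\<not> U < 3"
    then have "3 * U \<le> U\<^sup>2" by (simp add: power2_eq_square)
    moreover have "lam\<^sup>2 \<ge> 0" by simp
    ultimately show False using U2 lamU \<open>\<not> U < 3\<close> by linarith
  qed
  have "lam\<^sup>2 < (1 / 2)\<^sup>2" using assms by (intro power_strict_mono) auto
  then have "lam * U / 6 < 1 - lam\<^sup>2"
    using lamU \<open>U < 3\<close> by (simp add: power2_eq_square)
  then have "0 < - H / 4 - lam * U / 6" using H' by linarith
  then have "0 < U\<^sup>2 * (- H / 4 - lam * U / 6)" using \<open>U > 0\<close> by simp
  moreover have "potential lam U H = - H * U\<^sup>2 / 4"
  proof -
    have "potential lam U H = U * (U * (1 + H) - lam * H) / 2 + H * (H - lam * U) / 2"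
      by (simp add: potential_def field_simps power2_eq_square)
    also have "H - lam * U = - U\<^sup>2 / 2" using crit2 by simp
    also have "U * (U * (1 + H) - lam * H) / 2 + H * (- U\<^sup>2 / 2) / 2 = - H * U\<^sup>2 / 4"
      unfolding crit1 by simp
    finally show ?thesis .
  qed
  ultimately show ?thesis
    by (simp add: algebra_simps power2_eq_square power3_eq_cube)
qed

text \<open>Holds for every nonzero \<open>\<beta>\<close>; smallness of \<open>\<beta>\<close>
  serves only to contradict this bound.\<close>

lemma monotone_front_speed_large:
  assumes front: "monotone_front \<beta> u \<eta> lam" and "\<beta> \<noteq> 0"
  shows "lam \<ge> 1 / 2"
proof (rule ccontr)
  assume "\<not> lam \<ge> 1 / 2"
  define b where "b = \<beta>\<^sup>2"
  define mu where "mu = lam * (1 + 1 / (3 * b))"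
  have "b > 0" using \<open>\<beta> \<noteq> 0\<close> by (simp add: b_def)
  have C2: "C2 u" "C2 \<eta>" and lam: "lam > 0" "lam < 1 / 2"
    and sys: "solves_system \<beta> lam u \<eta>"
    and lim: "((\<lambda>x. (u x, \<eta> x)) \<longlongrightarrow> (0, 0)) at_top"
    and bdd: "bounded (range u)" "bounded (range \<eta>)"
      "bounded (range (deriv u))" "bounded (range (deriv \<eta>))"
    and u_pos: "\<And>x. u x > 0" and eta_neg: "\<And>x. \<eta> x < 0"
    and u'_le: "\<And>x. deriv u x \<le> 0" and eta'_ge: "\<And>x. deriv \<eta> x \<ge> 0"
    using front \<open>\<not> lam \<ge> 1 / 2\<close>
    by (auto simp: monotone_front_def bounded_C2_norm_def)
  have "mu > 0" using lam \<open>b > 0\<close> by (simp add: mu_def add_pos_pos)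
  note du = C2_has_derivatives(1)[OF C2(1)] and ddu = C2_has_derivatives(2)[OF C2(1)]
    and de = C2_has_derivatives(1)[OF C2(2)] and dde = C2_has_derivatives(2)[OF C2(2)]

  let ?Vu = "\<lambda>u \<eta>. u * (1 + \<eta>) - lam * \<eta>"
  let ?Ve = "\<lambda>u \<eta>. \<eta> - lam * u + u\<^sup>2 / 2"
  let ?p' = "\<lambda>x. deriv u x - mu * deriv \<eta> x"
  let ?p'' = "\<lambda>x. deriv (deriv u) x - mu * deriv (deriv \<eta>) x"
  let ?z' = "\<lambda>x. deriv \<eta> x - lam * deriv u x"
  let ?z'' = "\<lambda>x. deriv (deriv \<eta>) x - lam * deriv (deriv u) x"
  have dp': "(?p' has_real_derivative ?p'' x) (at x)" for x
    by (auto intro!: derivative_eq_intros ddu dde)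
  have dz': "(?z' has_real_derivative ?z'' x) (at x)" for x
    by (auto intro!: derivative_eq_intros ddu dde)
  have p'': "?p'' x = ?Vu (u x) (\<eta> x) / b" for x
  proof -
    have "u x - mu * \<eta> x - b * ?p'' x + (lam / (3 * b) + u x) * \<eta> x = 0"
      using sys unfolding solves_system_def b_def[symmetric] mu_def[symmetric]
        L_op_diff_scaled[OF C2] by blast
    \<comment> \<open>The linear terms in \<open>\<eta>\<close> thus combine to
      \<open>- lam * \<eta>\<close>, as the gradient form requires.\<close>
    moreover have "lam / (3 * b) = mu - lam" by (simp add: mu_def field_simps)
    ultimately have "u x - mu * \<eta> x - b * ?p'' x + (mu - lam + u x) * \<eta> x = 0"
      by simp
    then have "b * ?p'' x = ?Vu (u x) (\<eta> x)" by (simp add: algebra_simps)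
    then show ?thesis using \<open>b > 0\<close> by (simp add: field_simps)
  qed
  have z'': "?z'' x = ?Ve (u x) (\<eta> x) / b" for x
  proof -
    have "\<eta> x - lam * u x - b * ?z'' x + 1 / 2 * (u x)\<^sup>2 = 0"
      using sys unfolding solves_system_def b_def[symmetric]
        L_op_diff_scaled[OF C2(2,1)] by blast
    then have "b * ?z'' x = ?Ve (u x) (\<eta> x)" by simp
    then show ?thesis using \<open>b > 0\<close> by (simp add: field_simps)
  qed

  \<comment> \<open>Limit of the front at -\<infinity>\<close>
  have "antimono u" using antimonoI_deriv_nonpos[OF du u'_le] .
  then obtain U where U: "(u \<longlongrightarrow> U) at_bot" "\<And>x. u x \<le> U"
    using antimono_bounded_limit_at_bot bdd(1) by blast
  have "antimono (\<lambda>x. - \<eta> x)"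
    using antimonoI_deriv_nonpos[of "\<lambda>x. - \<eta> x"] DERIV_minus[OF de] eta'_ge by fastforce
  moreover have "bounded (range (\<lambda>x. - \<eta> x))" using bdd(2) by (simp add: bounded_iff)
  ultimately obtain H' where H': "((\<lambda>x. - \<eta> x) \<longlongrightarrow> H') at_bot" "\<And>x. - \<eta> x \<le> H'"
    using antimono_bounded_limit_at_bot by blast
  define H where "H = - H'"
  have H: "(\<eta> \<longlongrightarrow> H) at_bot" "\<And>x. H \<le> \<eta> x"
    using tendsto_minus[OF H'(1)] H'(2) by (simp_all add: H_def minus_le_iff)
  have "U > 0" using U(2)[of 0] u_pos[of 0] by linarith

  have bdd_comb: "bounded (range (\<lambda>x. f x - c * g x))"
    if "bounded (range f)" "bounded (range g)" for f g :: "real \<Rightarrow> real" and c :: real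
    using bounded_minus_comp[of f UNIV "\<lambda>x. c * g x"] bounded_scaling[OF that(2), of c] that(1)
    by (simp add: image_image)
  have "?Vu U H / b = 0"
  proof (rule bounded_deriv_limit_at_bot_zero[OF dp'])
    show "bounded (range ?p')" by (rule bdd_comb[OF bdd(3,4)])
    show "(?p'' \<longlongrightarrow> ?Vu U H / b) at_bot"
      unfolding p'' using \<open>b > 0\<close> by (auto intro!: tendsto_intros U(1) H(1))
  qed
  then have crit1: "U * (1 + H) = lam * H" using \<open>b > 0\<close> by simp
  have "?Ve U H / b = 0"
  proof (rule bounded_deriv_limit_at_bot_zero[OF dz'])
    show "bounded (range ?z')" by (rule bdd_comb[OF bdd(4,3)])
    show "(?z'' \<longlongrightarrow> ?Ve U H / b) at_bot"
      unfolding z'' using \<open>b > 0\<close> by (auto intro!: tendsto_intros U(1) H(1))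
  qed
  then have crit2: "?Ve U H = 0" using \<open>b > 0\<close> by simp

  \<comment> \<open>The cubic term replaces \<open>- ?Ve\<close> by
    \<open>u\<^sup>2 / 2 - ?Ve = lam * u - \<eta>\<close>, which is positive, in the factor of
    \<open>deriv u\<close> in the derivative of \<open>Phi\<close>.\<close>
  define W where "W = (\<lambda>x. potential lam (u x) (\<eta> x) - lam * u x ^ 3 / 6)"
  define Phi where "Phi = (\<lambda>x. b * ((?p' x)\<^sup>2 + (?z' x)\<^sup>2) / 2 - W x)"
  have dPhi: "(Phi has_real_derivative
      - mu * ?Vu (u x) (\<eta> x) * deriv \<eta> x
      + lam * (u x ^ 2 / 2 - ?Ve (u x) (\<eta> x)) * deriv u x) (at x)" for x
  proof -
    have dW: "(W has_real_derivative
        ?Vu (u x) (\<eta> x) * deriv u x + ?Ve (u x) (\<eta> x) * deriv \<eta> x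
          - lam * u x ^ 2 / 2 * deriv u x) (at x)"
      unfolding W_def potential_def
      by (rule derivative_eq_intros du de refl | simp)+
         (simp add: field_simps power2_eq_square)
    have Phi': "(Phi has_real_derivative
        b * (2 * ?p' x * ?p'' x + 2 * ?z' x * ?z'' x) / 2
        - (?Vu (u x) (\<eta> x) * deriv u x + ?Ve (u x) (\<eta> x) * deriv \<eta> x
          - lam * u x ^ 2 / 2 * deriv u x)) (at x)"
      unfolding Phi_def
      by (intro DERIV_diff DERIV_cdivide DERIV_cmult DERIV_add DERIV_square dp' dz' dW)
    have kinetic: "b * (2 * ?p' x * ?p'' x + 2 * ?z' x * ?z'' x) / 2
        = ?p' x * ?Vu (u x) (\<eta> x) + ?z' x * ?Ve (u x) (\<eta> x)"
      unfolding p'' z'' using \<open>b > 0\<close> by (simp add: field_simps)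
    show ?thesis
      by (rule DERIV_cong[OF Phi'], unfold kinetic) (simp add: field_simps)
  qed
  have "antimono Phi"
  proof (rule antimonoI_deriv_nonpos[OF dPhi])
    fix x
    have "0 \<le> ?Vu (u x) (\<eta> x)"
      using partial_u_potential_nonneg[OF lam(1) u_pos U(2) H(2) eta_neg crit1] .
    then have "0 \<le> mu * ?Vu (u x) (\<eta> x) * deriv \<eta> x"
      using \<open>mu > 0\<close> eta'_ge by simp
    moreover have "0 \<le> u x ^ 2 / 2 - ?Ve (u x) (\<eta> x)"
      using eta_neg[of x] mult_pos_pos[OF lam(1) u_pos[of x]] by simp
    then have "lam * (u x ^ 2 / 2 - ?Ve (u x) (\<eta> x)) * deriv u x \<le> 0"
      using lam(1) u'_le by (intro mult_nonneg_nonpos mult_nonneg_nonneg) auto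
    ultimately show "- mu * ?Vu (u x) (\<eta> x) * deriv \<eta> x
        + lam * (u x ^ 2 / 2 - ?Ve (u x) (\<eta> x)) * deriv u x \<le> 0"
      by simp
  qed

  \<comment> \<open>Sign of \<open>Phi\<close> and contradiction at -\<infinity>\<close>
  have lim_top: "(u \<longlongrightarrow> 0) at_top" "(\<eta> \<longlongrightarrow> 0) at_top"
    using tendsto_fst[OF lim] tendsto_snd[OF lim] by simp_all
  have "((\<lambda>x. - W x) \<longlongrightarrow> - (potential lam 0 0 - lam * 0 ^ 3 / 6)) at_top"
    unfolding W_def potential_def by (intro tendsto_intros lim_top) simp_all
  then have W_top: "((\<lambda>x. - W x) \<longlongrightarrow> 0) at_top" by (simp add: potential_def)
  have Phi_nonneg: "Phi x \<ge> 0" for x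
  proof (rule tendsto_upperbound[OF W_top])
    \<comment> \<open>Dropping the squares leaves \<open>- W\<close>, whose limit follows from that
      of the front alone.\<close>
    have "- W y \<le> Phi x" if "x \<le> y" for y
    proof -
      have "- W y \<le> Phi y" using \<open>b > 0\<close> by (simp add: Phi_def)
      also have "\<dots> \<le> Phi x" using antimonoD[OF \<open>antimono Phi\<close> that] .
      finally show ?thesis .
    qed
    then show "eventually (\<lambda>y. - W y \<le> Phi x) at_top"
      by (auto simp: eventually_at_top_linorder)
  qed simp

  define W0 where "W0 = potential lam U H - lam * U ^ 3 / 6"
  have "W0 > 0"
    using potential_at_critical_point[OF lam \<open>U > 0\<close> crit1 crit2] by (simp add: W0_def)
  have "(W \<longlongrightarrow> W0) at_bot"
    unfolding W_def W0_def potential_def by (intro tendsto_intros U(1) H(1)) simp_all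
  then have ev: "eventually (\<lambda>x. W x > W0 / 2) at_bot"
    using \<open>W0 > 0\<close> by (auto dest: order_tendstoD(1)[of _ _ _ "W0 / 2"])
  \<comment> \<open>\<open>p'\<close> and \<open>z'\<close> have opposite signs, so the bounded function \<open>z - p\<close> controls both.\<close>
  let ?g = "\<lambda>x. (\<eta> x - lam * u x) - 1 * (u x - mu * \<eta> x)"
  have dg: "(?g has_real_derivative ?z' x - ?p' x) (at x)" for x
    by (auto intro!: derivative_eq_intros du de)
  \<comment> \<open>\<open>Phi \<ge> 0\<close> and \<open>W > W0 / 2\<close> bound the sum of the
    squares below by \<open>W0 / b\<close>.\<close>
  have "eventually (\<lambda>x. ?z' x - ?p' x \<ge> sqrt (W0 / b)) at_bot"
    using ev
  proof (rule eventually_mono)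
    fix x assume Wx: "W x > W0 / 2"
    have "lam * deriv u x \<le> 0" "0 \<le> mu * deriv \<eta> x"
      using lam(1) \<open>mu > 0\<close> u'_le[of x] eta'_ge[of x] by (simp_all add: mult_nonneg_nonpos)
    then have s: "?z' x \<ge> 0" "?p' x \<le> 0"
      using u'_le[of x] eta'_ge[of x] by linarith+
    have "W0 \<le> b * ((?p' x)\<^sup>2 + (?z' x)\<^sup>2)"
      using Phi_nonneg[of x] Wx by (simp add: Phi_def)
    then have "W0 / b \<le> (?p' x)\<^sup>2 + (?z' x)\<^sup>2"
      using \<open>b > 0\<close> by (simp add: field_simps)
    also have "\<dots> \<le> (?z' x - ?p' x)\<^sup>2"
      using mult_nonneg_nonpos[OF s] power2_diff[of "?z' x" "?p' x"] by linarith
    finally show "sqrt (W0 / b) \<le> ?z' x - ?p' x"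
      using s by (intro real_le_lsqrt) auto
  qed
  moreover have "bounded (range ?g)"
    by (rule bdd_comb[OF bdd_comb[OF bdd(2,1)] bdd_comb[OF bdd(1,2)]])
  ultimately show False
    using unbounded_if_deriv_bounded_below_at_bot[OF dg, of "sqrt (W0 / b)"] \<open>W0 > 0\<close> \<open>b > 0\<close>
    by simp
qed

theorem lemma2p7:
  shows "\<exists>\<beta>\<^sub>0 :: real. \<beta>\<^sub>0 > 0 \<and>
    (\<forall>\<beta> lam :: real. lam > 0 \<and> 0 < \<bar>\<beta>\<bar> \<and> \<bar>\<beta>\<bar> < \<beta>\<^sub>0 \<longrightarrow>
       \<not> (\<exists>u \<eta> :: real \<Rightarrow> real. monotone_front \<beta> u \<eta> lam))"
proof (intro exI[of _ "1 / 4"] conjI allI impI notI)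
  fix \<beta> lam :: real
  assume asm: "lam > 0 \<and> 0 < \<bar>\<beta>\<bar> \<and> \<bar>\<beta>\<bar> < 1 / 4"
    and "\<exists>u \<eta> :: real \<Rightarrow> real. monotone_front \<beta> u \<eta> lam"
  then obtain u \<eta> where front: "monotone_front \<beta> u \<eta> lam" by blast
  \<comment> \<open>The aim is \<open>1 / (3 * \<beta>\<^sup>2) \<ge> 3\<close>, which turns the
    speed condition of a front into \<open>lam < 1 / 2\<close>; the witness \<open>1 / 4\<close>
    leaves some room.\<close>
  have "\<bar>\<beta>\<bar>\<^sup>2 < (1 / 4)\<^sup>2" using asm by (intro power_strict_mono) auto
  then have "\<beta>\<^sup>2 < 1 / 16" by (simp add: power2_eq_square)
  moreover have "\<beta>\<^sup>2 > 0" using asm by simp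
  ultimately have "4 \<le> 1 + 1 / (3 * \<beta>\<^sup>2)" by (simp add: field_simps)
  then have "lam\<^sup>2 * 4 \<le> lam\<^sup>2 * (1 + 1 / (3 * \<beta>\<^sup>2))" by (intro mult_left_mono) auto
  also have "\<dots> < 1" using front by (simp add: monotone_front_def)
  finally have "lam\<^sup>2 < (1 / 2)\<^sup>2" by (simp add: power2_eq_square)
  then have "lam < 1 / 2" by (rule power2_less_imp_less) simp
  moreover have "lam \<ge> 1 / 2" using monotone_front_speed_large[OF front] asm by auto
  ultimately show False by simp
qed simp

end
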